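(* Let $T\ge2$ and let $\mathbf p\in\mathcal P$. The sequences generated by the alternate projections method on $\mathcal X$ and $\mathcal Y_{\mathbf p}$ converge to points $\mathbf x^*\in\mathcal X$, $\mathbf y^*\in\mathcal Y_{\mathbf p}$ satisfying $\|\mathbf x^*-\mathbf y^*\|_2=\inf_{\mathbf x\in\mathcal X,\mathbf y\in\mathcal Y_{\mathbf p}}\|\mathbf x-\mathbf y\|_2$, at the geometric rate $$\|\mathbf x^{(k)}-\mathbf x^*\|_2\le 2\,\|\mathbf x^{(0)}-\mathbf x^*\|_2\left(1-\frac{4}{N(T+1)^2(T-1)}\right)^k\qquad(k\ge0),$$ and the analogous inequality holds for $(\mathbf y^{(k)})_k$, namely $\|\mathbf y^{(k)}-\mathbf y^*\|_2\le 2\,\|\mathbf y^{(0)}-\mathbf y^*\|_2\left(1-\frac{4}{N(T+1)^2(T-1)}\right)^k$ for all $k\ge 0$.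
   Context: Let $N\ge1$, $T\ge 1$ be integers, $[N]=\{1,\dots,N\}$, $[T]=\{1,\dots,T\}$. For each $n\in[N]$ there are given $E_n>0$ and vectors $\underline{\mathbf x}_n,\overline{\mathbf x}_n\in\mathbb R^T$ such that $\mathcal X_n=\{\mathbf x_n\in\mathbb R^T:\ \sum_{t\in[T]}x_{n,t}=E_n,\ \underline x_{n,t}\le x_{n,t}\le\overline x_{n,t}\ \forall t\}$ is nonempty. Put $\mathcal X=\prod_{n\in[N]}\mathcal X_n\subset\mathbb R^{NT}$. $\mathcal P\subset\mathbb R^T$ is a set all of whose elements $\mathbf p$ satisfy $\sum_{t}p_t=\sum_n E_n$ and $\sum_n\underline x_{n,t}\le p_t\le\sum_n\overline x_{n,t}$ for all $t\in[T]$. For $\mathbf p\in\mathcal P$, $\mathcal Y_{\mathbf p}=\{\mathbf x\in\mathbb R^{NT}:\ \sum_{n\in[N]}x_{n,t}=p_t\ \forall t\in[T]\}$. Alternate projections method (APM): starting from $\mathbf x^{(0)}\in\mathcal X$, set $\mathbf y^{(k)}=P_{\mathcal Y_{\mathbf p}}(\mathbf x^{(k)})$ and $\mathbf x^{(k+1)}=P_{\mathcal X}(\mathbf y^{(k)})$ for $k\ge0$, where $P_C$ is the Euclidean projection onto the closed convex set $C$. *)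

theory Defs
  imports "HOL-Analysis.Analysis"
begin

text \<open>
  The index sets $[N]$ and $[T]$ are the finite types \<open>'n\<close> and \<open>'t\<close>, with $N$ and $T$ their
  cardinalities. A point of $\mathbb{R}^{NT}$ is a vector \<open>x :: real ^ 't ^ 'n\<close>, whose entry
  $x_{n,t}$ is \<open>x $ n $ t\<close>. The norm of this type is the Euclidean norm of the rows' Euclidean
  norms, that is, the Euclidean norm of $\mathbb{R}^{NT}$.
\<close>

definition agent_set :: "real \<Rightarrow> real ^ 't \<Rightarrow> real ^ 't \<Rightarrow> (real ^ 't::finite) set" where
  "agent_set e lo up = {v. (\<Sum>t\<in>UNIV. v $ t) = e \<and> (\<forall>t. lo $ t \<le> v $ t \<and> v $ t \<le> up $ t)}"

definition X_set ::
  "('n \<Rightarrow> real) \<Rightarrow> real ^ 't ^ 'n \<Rightarrow> real ^ 't ^ 'n \<Rightarrow> (real ^ 't::finite ^ 'n::finite) set" where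
  "X_set E lo up = {x. \<forall>n. x $ n \<in> agent_set (E n) (lo $ n) (up $ n)}"

definition Y_set :: "real ^ 't \<Rightarrow> (real ^ 't::finite ^ 'n::finite) set" where
  "Y_set p = {x. \<forall>t. (\<Sum>n\<in>UNIV. x $ n $ t) = p $ t}"

definition alternate_projections ::
  "'a::euclidean_space set \<Rightarrow> 'a set \<Rightarrow> (nat \<Rightarrow> 'a) \<Rightarrow> (nat \<Rightarrow> 'a) \<Rightarrow> bool" where
  "alternate_projections A B x y \<longleftrightarrow>
     x 0 \<in> A \<and>
     (\<forall>k. y k = closest_point B (x k)) \<and>
     (\<forall>k. x (Suc k) = closest_point A (y k))"

end

theory Submission imports Defs begin

text \<open>
  Alternate projections contract the distance to the set of best approximation points by
  \<open>1 - 1 / K\<close> per round as soon as the squared distance of a point of one set to that set is at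
  most \<open>K\<close> times its squared distance to the other set, translated by the gap vector.

  Here this regularity comes from a transportation argument. Let \<open>c\<close> be the projection of
  \<open>a \<in> X\<close> on the best approximation points in \<open>X\<close> and let \<open>w = c - a\<close>; its column sums are
  the prescribed correction \<open>\<delta>\<close>, its row sums vanish. Since \<open>c\<close> is nearest to \<open>a\<close>, no
  cycle can be cancelled from \<open>w\<close>, so the columns can be ordered such that in every row the
  negative entries precede the positive ones. Then the suffix sums of the rows are nonnegative and
  add up to those of \<open>\<delta>\<close>, whence \<open>\<parallel>w\<parallel>\<^sup>2 \<le> T (T - 1) \<parallel>\<delta>\<parallel>\<^sup>2\<close>, and \<open>4 T \<le> (T + 1)\<^sup>2\<close>.
\<close>

section \<open>Fejer monotone sequences with geometric decay\<close>

lemma dist_closest_point: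
  fixes S :: "'a::euclidean_space set"
  assumes "closed S" "S \<noteq> {}"
  shows "dist u (closest_point S u) = infdist u S"
  using setdist_closest_point[OF assms] assms(2) by (simp add: infdist_eq_setdist)

text \<open>Fejer monotonicity keeps all iterates from \<open>z k\<close> on in the ball around the
  projection \<open>e k\<close> of \<open>z k\<close> on \<open>C\<close>, whose radius
  \<open>infdist (z k) C\<close> decays geometrically. Hence the sequence is Cauchy, and its limit
  lies in each of these balls.\<close>

lemma Fejer_linear_convergence:
  fixes z :: "nat \<Rightarrow> 'a::euclidean_space"
  assumes "closed C" "C \<noteq> {}"
    and fejer: "\<And>k c. c \<in> C \<Longrightarrow> dist (z (Suc k)) c \<le> dist (z k) c"
    and contr: "\<And>k. infdist (z (Suc k)) C \<le> r * infdist (z k) C"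
    and r: "0 \<le> r" "r < 1"
  obtains l where "l \<in> C" "z \<longlonglongrightarrow> l" "\<And>k. dist (z k) l \<le> 2 * dist (z 0) l * r ^ k"
proof -
  define e where "e k = closest_point C (z k)" for k
  have eC: "e k \<in> C" and dist_e: "dist (z k) (e k) = infdist (z k) C" for k
  proof -
    show eC: "e k \<in> C" unfolding e_def by (rule closest_point_in_set[OF assms(1,2)])
    show "dist (z k) (e k) = infdist (z k) C"
      unfolding e_def by (rule dist_closest_point[OF assms(1,2)])
  qed
  have geo: "infdist (z k) C \<le> infdist (z 0) C * r ^ k" for k
  proof (induction k)
    case (Suc k)
    show ?case
      using contr[of k] mult_left_mono[OF Suc r(1)] by (simp add: mult_ac)
  qed simp
  have mono: "dist (z m) c \<le> dist (z k) c" if "c \<in> C" "k \<le> m" for k m c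
    using that(2) by (induction m rule: dec_induct) (use fejer[OF that(1)] order_trans in blast)+
  have near: "dist (z m) (e k) \<le> infdist (z k) C" if "k \<le> m" for k m
    using mono[OF eC that, of k] dist_e by simp
  have lim0: "(\<lambda>k. infdist (z 0) C * r ^ k) \<longlonglongrightarrow> 0"
    using tendsto_mult_right_zero[OF LIMSEQ_power_zero, of r] r by simp
  then have inf0: "(\<lambda>k. infdist (z k) C) \<longlonglongrightarrow> 0"
    by (rule tendsto_sandwich[OF _ _ tendsto_const, rotated 2])
      (auto simp: geo infdist_nonneg)
  have "Cauchy z"
  proof (rule metric_CauchyI)
    fix eps :: real assume "eps > 0"
    then have "\<forall>\<^sub>F k in sequentially. infdist (z k) C < eps / 2"
      using inf0 by (intro order_tendstoD) auto
    then obtain k where k: "infdist (z k) C < eps / 2"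
      unfolding eventually_sequentially by blast
    have "dist (z m) (z n) < eps" if "m \<ge> k" "n \<ge> k" for m n
      using near[OF that(1)] near[OF that(2)] k dist_triangle2[of "z m" "z n" "e k"] by linarith
    then show "\<exists>M. \<forall>m\<ge>M. \<forall>n\<ge>M. dist (z m) (z n) < eps" by blast
  qed
  then obtain l where l: "z \<longlonglongrightarrow> l"
    using convergent_def Cauchy_convergent by blast
  have "(\<lambda>k. infdist (z k) C) \<longlonglongrightarrow> infdist l C"
    using l by (rule tendsto_infdist)
  then have "infdist l C = 0"
    using inf0 LIMSEQ_unique by blast
  then have lC: "l \<in> C"
    using assms(1,2) in_closed_iff_infdist_zero by blast
  have "dist (z k) l \<le> 2 * dist (z 0) l * r ^ k" for k
  proof -
    have "dist l (e k) \<le> infdist (z k) C"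
      by (rule tendsto_upperbound[OF tendsto_dist[OF l tendsto_const]])
        (auto simp: eventually_sequentially intro: near)
    \<comment> \<open>The factor 2 arises here: \<open>z k\<close> and \<open>l\<close> both lie in
      the ball around \<open>e k\<close>.\<close>
    then have "dist (z k) l \<le> 2 * infdist (z k) C"
      using dist_e[of k] dist_triangle2[of "z k" l "e k"] by linarith
    also have "\<dots> \<le> 2 * (infdist (z 0) C * r ^ k)"
      using geo by simp
    also have "\<dots> \<le> 2 * (dist (z 0) l * r ^ k)"
      using infdist_le[OF lC] r by (intro mult_left_mono mult_right_mono) auto
    finally show ?thesis by simp
  qed
  with lC l show thesis by (rule that)
qed

section \<open>Projection inequalities and abstract alternate projections\<close>

lemma closest_point_firmly_nonexpansive:
  fixes S :: "'a::euclidean_space set"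
  assumes "convex S" "closed S" "S \<noteq> {}"
  shows "(norm (closest_point S u - closest_point S w))\<^sup>2 \<le>
    (norm (u - w))\<^sup>2 - (norm ((u - closest_point S u) - (w - closest_point S w)))\<^sup>2"
proof -
  let ?p = "closest_point S u" and ?q = "closest_point S w"
  \<comment> \<open>Write \<open>u - w\<close> as \<open>?p - ?q\<close> plus the difference of the
    residuals. The sum of the two inequalities says that the inner product of these two parts is
    nonnegative.\<close>
  have "(u - ?p) \<bullet> (?q - ?p) \<le> 0" "(w - ?q) \<bullet> (?p - ?q) \<le> 0"
    using assms by (auto intro!: closest_point_dot closest_point_in_set)
  then show ?thesis
    unfolding power2_norm_eq_inner by (simp add: inner_diff_left inner_diff_right inner_commute)
qed

lemma closest_point_Pythagoras:
  fixes S :: "'a::euclidean_space set"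
  assumes "convex S" "closed S" "s \<in> S"
  shows "(norm (closest_point S u - s))\<^sup>2 \<le> (norm (u - s))\<^sup>2 - (norm (u - closest_point S u))\<^sup>2"
proof -
  let ?p = "closest_point S u"
  have "(u - ?p) \<bullet> (s - ?p) \<le> 0"
    using assms by (rule closest_point_dot)
  then show ?thesis
    unfolding power2_norm_eq_inner by (simp add: inner_diff_left inner_diff_right inner_commute)
qed

text \<open>Weights \<open>K\<close> and \<open>K / (K - 1)\<close> on the two squares bound the
  square of the sum, and with this choice the contributions of \<open>d\<close> cancel. This carries
  the regularity constant from one set to the other without loss.\<close>

lemma square_add_le_weighted:
  fixes a b K :: real
  assumes "K > 1" "a\<^sup>2 \<le> r - d" "b\<^sup>2 \<le> (K - 1) * d"
  shows "(a + b)\<^sup>2 \<le> K * r"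
proof -
  have "0 \<le> ((K - 1) * a - b)\<^sup>2" by simp
  then have "(K - 1) * (a + b)\<^sup>2 \<le> (K - 1) * K * a\<^sup>2 + K * b\<^sup>2"
    by (simp add: power2_eq_square algebra_simps)
  also have "\<dots> \<le> (K - 1) * K * (r - d) + K * ((K - 1) * d)"
    using assms by (intro add_mono mult_left_mono) auto
  also have "\<dots> = (K - 1) * (K * r)" by (simp add: algebra_simps)
  finally show ?thesis using assms(1) by simp
qed

text \<open>Each of the two half steps contracts the squared distance to \<open>C\<close> by
  \<open>1 - 1 / K\<close>, so a full round contracts the distance itself by that factor.\<close>

theorem alternate_projections_linear_convergence:
  fixes A B :: "'a::euclidean_space set"
  assumes A: "convex A" "closed A" and B: "convex B" "closed B"
    and ab: "a0 \<in> A" "b0 \<in> B"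
    and minimal: "\<And>a b. a \<in> A \<Longrightarrow> b \<in> B \<Longrightarrow> norm (a0 - b0) \<le> norm (a - b)"
    and K: "K > 1"
    and regular: "\<And>a. a \<in> A \<Longrightarrow> \<exists>c\<in>A. c + (b0 - a0) \<in> B \<and>
          (\<forall>b\<in>B. (norm (a - c))\<^sup>2 \<le> K * (norm (a - (b - (b0 - a0))))\<^sup>2)"
    and apm: "alternate_projections A B x y"
  shows "\<exists>xs\<in>A. \<exists>ys\<in>B. x \<longlonglongrightarrow> xs \<and> y \<longlonglongrightarrow> ys \<and>
    norm (xs - ys) = (INF (a, b) \<in> A \<times> B. norm (a - b)) \<and>
    (\<forall>k. norm (x k - xs) \<le> 2 * norm (x 0 - xs) * (1 - 1 / K) ^ k) \<and>
    (\<forall>k. norm (y k - ys) \<le> 2 * norm (y 0 - ys) * (1 - 1 / K) ^ k)"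
proof -
  \<comment> \<open>Each \<open>c\<close> in \<open>C\<close> and its partner \<open>c + v\<close>
    realize the minimal distance. Moving the second sequence back by the gap vector \<open>v\<close>
    lets both sequences be compared with the single set \<open>C\<close>.\<close>
  define v where "v = b0 - a0"
  define C where "C = A \<inter> (\<lambda>c. c + v) -` B"
  define h where "h k = y k - v" for k
  have ne: "A \<noteq> {}" "B \<noteq> {}" using ab by auto
  have x0: "x 0 \<in> A" and y: "y k = closest_point B (x k)"
    and xSuc: "x (Suc k) = closest_point A (y k)" for k
    using apm by (auto simp: alternate_projections_def)
  have xA: "x k \<in> A" for k
    using x0 xSuc closest_point_in_set[OF A(2) ne(1)] by (cases k) auto
  have yB: "y k \<in> B" for k
    using y closest_point_in_set[OF B(2) ne(2)] by simp
  have gap: "norm v \<le> norm (a - b)" if "a \<in> A" "b \<in> B" for a b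
    using minimal[OF that] by (simp add: v_def norm_minus_commute)
  have closedC: "closed C"
    unfolding C_def by (intro closed_Int closed_vimage A B continuous_intros)
  have "a0 \<in> C" using ab by (simp add: C_def v_def)
  then have neC: "C \<noteq> {}" by auto
  have projB: "closest_point B c = c + v" if "c \<in> C" for c
    using that gap B
    by (intro closest_point_unique[symmetric]) (auto simp: C_def dist_norm)
  have projA: "closest_point A (c + v) = c" if "c \<in> C" for c
    using that gap A
    by (intro closest_point_unique[symmetric]) (auto simp: C_def dist_norm norm_minus_commute)
  \<comment> \<open>Firm nonexpansiveness is applied to \<open>x k\<close> and \<open>c\<close>. The
    residual of \<open>c\<close> is \<open>- v\<close>, so the gap drops out and the decrease is
    measured by \<open>x k - h k\<close>, not by \<open>x k - y k\<close>.\<close>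
  have step_h: "(norm (h k - c))\<^sup>2 \<le> (norm (x k - c))\<^sup>2 - (norm (x k - h k))\<^sup>2" if "c \<in> C" for k c
    using closest_point_firmly_nonexpansive[OF B ne(2), of "x k" c] projB[OF that] y[of k]
    by (simp add: h_def algebra_simps)
  have step_x: "(norm (x (Suc k) - c))\<^sup>2 \<le> (norm (h k - c))\<^sup>2 - (norm (h k - x (Suc k)))\<^sup>2"
    if "c \<in> C" for k c
    using closest_point_firmly_nonexpansive[OF A ne(1), of "y k" "c + v"] projA[OF that] xSuc[of k]
    by (simp add: h_def algebra_simps)
  have regA: "\<exists>c\<in>C. (norm (a - c))\<^sup>2 \<le> K * (norm (a - (b - v)))\<^sup>2" if "a \<in> A" "b \<in> B" for a b
    using regular[OF that(1)] that(2) by (auto simp: C_def v_def)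
  have regB: "\<exists>c\<in>C. (norm ((b - v) - c))\<^sup>2 \<le> K * (norm ((b - v) - a))\<^sup>2"
    if aA: "a \<in> A" and bB: "b \<in> B" for a b
  proof -
    \<comment> \<open>\<open>q - v\<close> is the point of the translated \<open>B\<close> nearest
      to \<open>a\<close>. Regularity at \<open>a\<close> gives \<open>c\<close>; the obtuse angle
      at \<open>q\<close> bounds its distances to \<open>c + v\<close> and to \<open>b\<close>, and
      the weighted inequality recovers the same \<open>K\<close>.\<close>
    define q where "q = closest_point B (a + v)"
    have qB: "q \<in> B" unfolding q_def by (rule closest_point_in_set[OF B(2) ne(2)])
    obtain c where c: "c \<in> C" and le: "(norm (a - c))\<^sup>2 \<le> K * (norm (a - (q - v)))\<^sup>2"
      using regA[OF aA qB] by blast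
    have "c + v \<in> B" using c by (simp add: C_def)
    from closest_point_Pythagoras[OF B this, of "a + v"]
    have "(norm (q - (c + v)))\<^sup>2 \<le> (K - 1) * (norm (a - (q - v)))\<^sup>2"
      using le by (simp add: q_def[symmetric] algebra_simps)
    moreover have "(norm (q - b))\<^sup>2 \<le> (norm ((b - v) - a))\<^sup>2 - (norm (a - (q - v)))\<^sup>2"
      using closest_point_Pythagoras[OF B bB, of "a + v"]
      by (simp add: q_def[symmetric] norm_minus_commute algebra_simps)
    ultimately have "(norm (q - b) + norm (q - (c + v)))\<^sup>2 \<le> K * (norm ((b - v) - a))\<^sup>2"
      using square_add_le_weighted[OF K] by blast
    moreover have "norm ((b - v) - c) \<le> norm (q - b) + norm (q - (c + v))"
      using norm_triangle_ineq4[of "q - (c + v)" "q - b"] by (simp add: algebra_simps)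
    then have "(norm ((b - v) - c))\<^sup>2 \<le> (norm (q - b) + norm (q - (c + v)))\<^sup>2"
      by (intro power_mono) auto
    ultimately show ?thesis using c by (meson order_trans)
  qed
  have contract: "(infdist u' C)\<^sup>2 \<le> (1 - 1 / K) * (infdist u C)\<^sup>2"
    if step: "\<And>c. c \<in> C \<Longrightarrow> (norm (u' - c))\<^sup>2 \<le> (norm (u - c))\<^sup>2 - (norm (u - u'))\<^sup>2"
      and reg: "\<exists>c\<in>C. (norm (u - c))\<^sup>2 \<le> K * (norm (u - u'))\<^sup>2" for u u'
  proof -
    obtain c where c: "c \<in> C" "infdist u C = norm (u - c)"
      using infdist_attains_inf[OF closedC neC] by (metis dist_norm)
    obtain d where "d \<in> C" "(norm (u - d))\<^sup>2 \<le> K * (norm (u - u'))\<^sup>2"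
      using reg by blast
    \<comment> \<open>The regularity point \<open>d\<close> may differ from the nearest point
      \<open>c\<close>; it only shows that the decrease is at least the fraction
      \<open>1 / K\<close> of the squared distance.\<close>
    then have "(infdist u C)\<^sup>2 \<le> K * (norm (u - u'))\<^sup>2"
      using power_mono[OF infdist_le[of d C u] infdist_nonneg, of 2] by (simp add: dist_norm)
    then have "(infdist u C)\<^sup>2 / K \<le> (norm (u - u'))\<^sup>2"
      using K by (simp add: field_simps)
    moreover have "(infdist u' C)\<^sup>2 \<le> (norm (u' - c))\<^sup>2"
      using power_mono[OF infdist_le[OF c(1), of u'] infdist_nonneg, of 2] by (simp add: dist_norm)
    ultimately show ?thesis
      using step[OF c(1)] c(2) by (simp add: algebra_simps)
  qed
  have rho: "0 \<le> 1 - 1 / K" "1 - 1 / K < 1" using K by auto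
  have con_h: "(infdist (h k) C)\<^sup>2 \<le> (1 - 1 / K) * (infdist (x k) C)\<^sup>2" for k
    using step_h regA[OF xA yB] by (intro contract) (auto simp: h_def)
  have con_x: "(infdist (x (Suc k)) C)\<^sup>2 \<le> (1 - 1 / K) * (infdist (h k) C)\<^sup>2" for k
    using step_x regB[OF xA yB] by (intro contract) (auto simp: h_def)
  have two: "a \<le> r * b" if "a\<^sup>2 \<le> r * s" "s \<le> r * b\<^sup>2" "0 \<le> r" "0 \<le> b" for a b r s :: real
  proof (rule power2_le_imp_le)
    show "a\<^sup>2 \<le> (r * b)\<^sup>2"
      using that(1) mult_left_mono[OF that(2,3)] by (simp add: power2_eq_square mult_ac)
  qed (use that in simp)
  have fej_h: "dist (h k) c \<le> dist (x k) c" if "c \<in> C" for k c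
    unfolding dist_norm
  proof (rule power2_le_imp_le)
    show "(norm (h k - c))\<^sup>2 \<le> (norm (x k - c))\<^sup>2"
      using step_h[OF that, of k] zero_le_power2[of "norm (x k - h k)"] by linarith
  qed simp
  have fej_x: "dist (x (Suc k)) c \<le> dist (h k) c" if "c \<in> C" for k c
    unfolding dist_norm
  proof (rule power2_le_imp_le)
    show "(norm (x (Suc k) - c))\<^sup>2 \<le> (norm (h k - c))\<^sup>2"
      using step_x[OF that, of k] zero_le_power2[of "norm (h k - x (Suc k))"] by linarith
  qed simp
  obtain xs where xs: "xs \<in> C" "x \<longlonglongrightarrow> xs"
    "\<And>k. dist (x k) xs \<le> 2 * dist (x 0) xs * (1 - 1 / K) ^ k"
  proof (rule Fejer_linear_convergence[OF closedC neC _ _ rho])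
    show "dist (x (Suc k)) c \<le> dist (x k) c" if "c \<in> C" for k c
      using fej_h[OF that] fej_x[OF that] order_trans by blast
    show "infdist (x (Suc k)) C \<le> (1 - 1 / K) * infdist (x k) C" for k
      using two[OF con_x con_h rho(1) infdist_nonneg] .
  qed auto
  obtain hs where hs: "hs \<in> C" "h \<longlonglongrightarrow> hs"
    "\<And>k. dist (h k) hs \<le> 2 * dist (h 0) hs * (1 - 1 / K) ^ k"
  proof (rule Fejer_linear_convergence[OF closedC neC _ _ rho])
    show "dist (h (Suc k)) c \<le> dist (h k) c" if "c \<in> C" for k c
      using fej_h[OF that] fej_x[OF that] order_trans by blast
    show "infdist (h (Suc k)) C \<le> (1 - 1 / K) * infdist (h k) C" for k
      using two[OF con_h con_x rho(1) infdist_nonneg] .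
  qed auto
  \<comment> \<open>Continuity of the projection identifies the limit of \<open>y\<close>, and
    thereby that of \<open>h\<close>, with the one found for \<open>x\<close>.\<close>
  have "isCont (closest_point B) xs"
    using continuous_at_closest_point[OF B ne(2)] .
  from isCont_tendsto_compose[OF this xs(2)] have "y \<longlonglongrightarrow> closest_point B xs"
    by (simp add: y[symmetric])
  then have y_lim: "y \<longlonglongrightarrow> xs + v"
    using projB[OF xs(1)] by simp
  then have "h \<longlonglongrightarrow> xs"
    using tendsto_diff[OF y_lim tendsto_const[of v]] by (simp add: h_def[abs_def])
  then have "hs = xs" using hs(2) LIMSEQ_unique by blast
  have "(INF (a, b) \<in> A \<times> B. norm (a - b)) = norm (xs - (xs + v))"
    using xs(1) gap by (intro cInf_eq_minimum) (force simp: C_def)+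
  moreover have "norm (y k - (xs + v)) \<le> 2 * norm (y 0 - (xs + v)) * (1 - 1 / K) ^ k" for k
    using hs(3)[of k] by (simp add: \<open>hs = xs\<close> dist_norm h_def diff_diff_eq2 algebra_simps)
  ultimately show ?thesis
    using xs y_lim unfolding C_def dist_norm
    by (intro bexI[of _ xs] bexI[of _ "xs + v"]) auto
qed

section \<open>Cycles of finite maps and topological orderings\<close>

lemma exists_bij_subset:
  assumes "finite Q" "Q \<noteq> {}" "g ` Q \<subseteq> Q"
  obtains C where "C \<subseteq> Q" "C \<noteq> {}" "bij_betw g C C"
proof -
  let ?P = "\<lambda>C. C \<subseteq> Q \<and> C \<noteq> {} \<and> g ` C \<subseteq> C"
  \<comment> \<open>The image of a nonempty invariant set is again nonempty and invariant, so
    minimal cardinality makes \<open>g\<close> map \<open>C\<close> onto itself.\<close>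
  obtain C where C: "?P C" and least: "\<And>D. ?P D \<Longrightarrow> card C \<le> card D"
    using ex_has_least_nat[of ?P Q card] assms by blast
  have fin: "finite C" using C assms(1) finite_subset by blast
  have "card C \<le> card (g ` C)"
    using C by (intro least) auto
  then have "card (g ` C) = card C" "g ` C = C"
    using fin C card_image_le[OF fin, of g] card_seteq[OF fin, of "g ` C"] by auto
  then have "bij_betw g C C"
    using fin by (simp add: bij_betw_def eq_card_imp_inj_on)
  with C that show thesis by blast
qed

text \<open>An element without predecessor is put first and removed. Acyclicity is stated through
  such elements because \<open>r\<close> need not be transitive and cycle cancelling yields exactly
  this form.\<close>

lemma topological_sort_exists:
  assumes "finite Q"
    and "\<And>R. R \<subseteq> Q \<Longrightarrow> R \<noteq> {} \<Longrightarrow> \<exists>t\<in>R. \<forall>s\<in>R. \<not> r s t"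
  shows "\<exists>ts. set ts = Q \<and> distinct ts \<and> sorted_wrt (\<lambda>t s. \<not> r s t) ts"
  using assms
proof (induction Q rule: finite_psubset_induct)
  case (psubset Q)
  show ?case
  proof (cases "Q = {}")
    case False
    then obtain t where t: "t \<in> Q" "\<forall>s\<in>Q. \<not> r s t"
      using psubset.prems by blast
    have "\<exists>ts. set ts = Q - {t} \<and> distinct ts \<and> sorted_wrt (\<lambda>t s. \<not> r s t) ts"
    proof (rule psubset.IH)
      show "\<exists>t\<in>R. \<forall>s\<in>R. \<not> r s t" if "R \<subseteq> Q - {t}" "R \<noteq> {}" for R
        using that by (intro psubset.prems) auto
    qed (use t in blast)
    then obtain ts where "set ts = Q - {t}" "distinct ts" "sorted_wrt (\<lambda>t s. \<not> r s t) ts"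
      by blast
    then show ?thesis
      using t by (intro exI[of _ "t # ts"]) auto
  qed simp
qed

section \<open>Matrices with vanishing row sums: suffix sums and cycle cancelling\<close>

lemma suffix_sum_nonneg:
  fixes f :: "nat \<Rightarrow> real"
  assumes "sum f {..<T} = 0"
    and "\<And>i j. i < j \<Longrightarrow> j < T \<Longrightarrow> \<not> (f j < 0 \<and> 0 < f i)"
  shows "0 \<le> sum f {j..<T}"
proof (cases "\<exists>i\<in>{j..<T}. f i < 0")
  case True
  \<comment> \<open>A negative entry at or after \<open>j\<close> makes every entry before
    \<open>j\<close> nonpositive, so the suffix, being minus the prefix, is nonnegative. Otherwise
    the suffix has only nonnegative terms.\<close>
  then obtain i where i: "j \<le> i" "i < T" "f i < 0" by auto
  have "{..<T} = {..<j} \<union> {j..<T}" using i by auto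
  then have "sum f {..<j} + sum f {j..<T} = 0"
    using assms(1) by (metis finite_lessThan finite_atLeastLessThan sum.union_disjoint
        ivl_disj_int_one(2) lessThan_atLeast0 ivl_disj_int_two(3))
  moreover have "sum f {..<j} \<le> 0"
    using assms(2)[of _ i] i by (intro sum_nonpos) (auto simp: not_less)
  ultimately show ?thesis by simp
qed (auto intro!: sum_nonneg simp: not_less)

lemma sum_squares_le_suffix_sums:
  fixes f :: "nat \<Rightarrow> real"
  assumes zero: "sum f {..<T} = 0"
    and nonneg: "\<And>j. 0 \<le> sum f {j..<T}"
  shows "(\<Sum>i<T. (f i)\<^sup>2) \<le> 2 * (\<Sum>j<T. (sum f {j..<T})\<^sup>2)"
proof -
  let ?s = "\<lambda>j. sum f {j..<T}"
  have "(f i)\<^sup>2 \<le> (?s i)\<^sup>2 + (?s (Suc i))\<^sup>2" if "i < T" for i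
  proof -
    have "?s i = f i + ?s (Suc i)" using that by (simp add: sum.atLeast_Suc_lessThan)
    moreover have "0 \<le> ?s i * ?s (Suc i)" using nonneg by simp
    ultimately show ?thesis by (simp add: power2_eq_square algebra_simps)
  qed
  then have "(\<Sum>i<T. (f i)\<^sup>2) \<le> (\<Sum>i<T. (?s i)\<^sup>2) + (\<Sum>i<T. (?s (Suc i))\<^sup>2)"
    unfolding sum.distrib[symmetric] by (intro sum_mono) simp
  moreover have "(\<Sum>i<T. (?s (Suc i))\<^sup>2) = (\<Sum>i<T. (?s i)\<^sup>2)"
    using sum.lessThan_Suc_shift[of "\<lambda>i. (?s i)\<^sup>2" T] zero
    by (simp add: lessThan_atLeast0)
  ultimately show ?thesis by simp
qed

lemma sum_squares_le_square_sum:
  fixes f :: "'a \<Rightarrow> real"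
  assumes "finite S" "\<And>i. i \<in> S \<Longrightarrow> 0 \<le> f i"
  shows "(\<Sum>i\<in>S. (f i)\<^sup>2) \<le> (sum f S)\<^sup>2"
  using assms
proof (induction S rule: finite_induct)
  case (insert a S)
  have "0 \<le> f a * sum f S" using insert.prems by (intro mult_nonneg_nonneg sum_nonneg) auto
  with insert show ?case by (simp add: power2_eq_square algebra_simps) 
qed simp

lemma square_sum_le_card:
  fixes f :: "'a \<Rightarrow> real"
  shows "(sum f S)\<^sup>2 \<le> real (card S) * (\<Sum>i\<in>S. (f i)\<^sup>2)"
  using Cauchy_Schwarz_ineq_sum[of f "\<lambda>_. 1" S] by (simp add: mult.commute)

text \<open>Once the columns are sorted, nonnegative suffix sums of different rows cannot cancel, so
  the sum of their squares is at most the square of their sum. This is why the bound does not depend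
  on the number of rows.\<close>

lemma zero_row_sums_bound:
  fixes w :: "'n::finite \<Rightarrow> 't::finite \<Rightarrow> real"
  assumes rows: "\<And>n. (\<Sum>t\<in>UNIV. w n t) = 0"
    and acyclic: "\<And>Q. Q \<noteq> {} \<Longrightarrow> \<exists>t\<in>Q. \<forall>s\<in>Q. \<not> (\<exists>n. w n s < 0 \<and> 0 < w n t)"
  shows "(\<Sum>n\<in>UNIV. \<Sum>t\<in>UNIV. (w n t)\<^sup>2) \<le>
    real CARD('t) * (real CARD('t) - 1) * (\<Sum>t\<in>UNIV. (\<Sum>n\<in>UNIV. w n t)\<^sup>2)"
proof -
  define T where "T = CARD('t)"
  obtain ts :: "'t list" where ts: "set ts = UNIV" "distinct ts"
    and sorted: "sorted_wrt (\<lambda>t s. \<not> (\<exists>n. w n s < 0 \<and> 0 < w n t)) ts"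
    using topological_sort_exists[of UNIV "\<lambda>s t. \<exists>n. w n s < 0 \<and> 0 < w n t"] acyclic by auto
  have len: "length ts = T" using distinct_card[OF ts(2)] ts(1) by (simp add: T_def)
  have "bij_betw ((!) ts) {..<T} UNIV"
    using bij_betw_nth[OF ts(2)] len ts(1) by metis
  then have reindex: "(\<Sum>i<T. f (ts ! i)) = (\<Sum>t\<in>UNIV. f t)" for f :: "'t \<Rightarrow> real"
    by (rule sum.reindex_bij_betw)
  define u where "u n i = w n (ts ! i)" for n i
  define d where "d i = (\<Sum>n\<in>UNIV. u n i)" for i
  let ?D = "\<Sum>i<T. (d i)\<^sup>2"
  have zero: "sum (u n) {..<T} = 0" for n
    using rows reindex[of "w n"] by (simp add: u_def)
  have nonneg: "0 \<le> sum (u n) {j..<T}" for n j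
  proof (rule suffix_sum_nonneg[OF zero])
    show "\<not> (u n j < 0 \<and> 0 < u n i)" if "i < j" "j < T" for i j
      using sorted_wrt_nth_less[OF sorted that(1)] that(2) len by (auto simp: u_def)
  qed
  have tail: "sum d {j..<T} = (\<Sum>n\<in>UNIV. sum (u n) {j..<T})" for j
    unfolding d_def by (rule sum.swap)
  \<comment> \<open>The full sum at \<open>j = 0\<close> vanishes with the row sums. Counting it
    with weight \<open>T\<close> would give the factor \<open>T (T + 1)\<close> instead of
    \<open>T (T - 1)\<close>.\<close>
  have cut: "(sum d {j..<T})\<^sup>2 \<le> (if j = 0 then 0 else real T - real j) * ?D" if "j < T" for j
  proof (cases "j = 0")
    case False
    have "(sum d {j..<T})\<^sup>2 \<le> real (card {j..<T}) * (\<Sum>i\<in>{j..<T}. (d i)\<^sup>2)"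
      by (rule square_sum_le_card)
    also have "\<dots> \<le> (real T - real j) * ?D"
      using that by (intro mult_mono sum_mono2) (auto simp: of_nat_diff intro: sum_nonneg)
    finally show ?thesis using False by simp
  qed (use zero in \<open>simp add: tail lessThan_atLeast0\<close>)
  have arith: "2 * (\<Sum>j<T. if j = 0 then 0 else real T - real j) = real T * (real T - 1)"
  proof -
    \<comment> \<open>The constant \<open>c\<close> is kept apart from the summation bound so that
      the induction on \<open>m\<close> goes through.\<close>
    have "(\<Sum>j<Suc m. if j = 0 then 0 else c - real j) = real m * c - real m * (real m + 1) / 2"
      for m c by (induction m) (auto simp: field_simps)
    from this[of "real T" "T - 1"] show ?thesis
      by (simp add: T_def field_simps of_nat_diff)
  qed
  have "(\<Sum>n\<in>UNIV. \<Sum>t\<in>UNIV. (w n t)\<^sup>2) = (\<Sum>n\<in>UNIV. \<Sum>i<T. (u n i)\<^sup>2)"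
    unfolding u_def by (simp add: reindex[of "\<lambda>t. (w _ t)\<^sup>2"])
  also have "\<dots> \<le> (\<Sum>n\<in>UNIV. 2 * (\<Sum>j<T. (sum (u n) {j..<T})\<^sup>2))"
    by (intro sum_mono sum_squares_le_suffix_sums zero nonneg)
  also have "\<dots> = 2 * (\<Sum>j<T. \<Sum>n\<in>UNIV. (sum (u n) {j..<T})\<^sup>2)"
    unfolding sum_distrib_left[symmetric] by (subst sum.swap) simp
  also have "\<dots> \<le> 2 * (\<Sum>j<T. (sum d {j..<T})\<^sup>2)"
    unfolding tail by (intro mult_left_mono sum_mono sum_squares_le_square_sum nonneg) auto
  also have "\<dots> \<le> 2 * (\<Sum>j<T. (if j = 0 then 0 else real T - real j) * ?D)"
    by (intro mult_left_mono sum_mono cut) auto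
  also have "\<dots> = real T * (real T - 1) * ?D"
    unfolding sum_distrib_right[symmetric] arith[symmetric] by simp
  also have "?D = (\<Sum>t\<in>UNIV. (\<Sum>n\<in>UNIV. w n t)\<^sup>2)"
    unfolding d_def u_def by (rule reindex)
  finally show ?thesis unfolding T_def .
qed

text \<open>Following the links from each column of \<open>Q\<close> must close up in a cycle, along
  which a small amount is moved against the signs of \<open>w\<close>. The matrix \<open>z\<close>
  so obtained never exceeds \<open>w\<close> in absolute value.\<close>

lemma cycle_cancelling:
  fixes w :: "'n::finite \<Rightarrow> 't::finite \<Rightarrow> real"
  assumes "Q \<noteq> {}" and "\<And>t. t \<in> Q \<Longrightarrow> \<exists>s\<in>Q. \<exists>n. w n s < 0 \<and> 0 < w n t"
  obtains z where "\<And>n. (\<Sum>t\<in>UNIV. z n t) = 0" "\<And>t. (\<Sum>n\<in>UNIV. z n t) = 0"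
    "\<And>n t. 0 < z n t \<Longrightarrow> w n t \<le> - z n t" "\<And>n t. z n t < 0 \<Longrightarrow> - z n t \<le> w n t"
    "\<exists>n t. z n t \<noteq> 0"
proof -
  from assms(2) obtain g m where g: "\<And>t. t \<in> Q \<Longrightarrow> g t \<in> Q"
    and gm: "\<And>t. t \<in> Q \<Longrightarrow> w (m t) (g t) < 0 \<and> 0 < w (m t) t"
    by metis
  obtain C where C: "C \<subseteq> Q" "C \<noteq> {}" "bij_betw g C C"
    using exists_bij_subset[of Q g] assms(1) g by auto
  define f where "f = the_inv_into C g"
  have f: "bij_betw f C C" unfolding f_def using bij_betw_the_inv_into[OF C(3)] .
  have gf: "g (f t) = t" if "t \<in> C" for t
    unfolding f_def using C(3) that by (simp add: bij_betw_def f_the_inv_into_f)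
  have fC: "f t \<in> C" if "t \<in> C" for t using f that by (auto simp: bij_betw_def)
  have neg: "w (m (f t)) t < 0" and pos: "0 < w (m t) t" if "t \<in> C" for t
    using gm[of "f t"] gm[of t] gf[OF that] fC[OF that] that C(1) by auto
  \<comment> \<open>The minimum over all nonzero entries is at most each entry met on the cycle,
    hence a safe amount to move.\<close>
  define e where "e = Min ((\<lambda>(n, t). \<bar>w n t\<bar>) ` {(n, t). w n t \<noteq> 0})"
  obtain c where c: "c \<in> C" using C(2) by blast
  have "(m c, c) \<in> {(n, t). w n t \<noteq> 0}" using pos[OF c] by simp
  then have e: "0 < e" unfolding e_def by (subst Min_gr_iff) auto
  have e_le: "e \<le> \<bar>w n t\<bar>" if "w n t \<noteq> 0" for n t
    unfolding e_def using that by (intro Min_le) force+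
  \<comment> \<open>In row \<open>m s\<close> the amount \<open>e\<close> is taken from column
    \<open>s\<close> and given to column \<open>g s\<close>. The inverse \<open>f\<close> of
    \<open>g\<close> names the unique donor of each column, so column sums cancel. The two
    indicators never coincide, since \<open>w\<close> has opposite signs there.\<close>
  define z where "z n t = e * (of_bool (t \<in> C \<and> m (f t) = n) - of_bool (t \<in> C \<and> m t = n))" for n t
  have "(\<Sum>t\<in>UNIV. z n t) = 0" for n
  proof -
    have "(\<Sum>t\<in>UNIV. of_bool (t \<in> C \<and> m (f t) = n)) = (\<Sum>t\<in>C. of_bool (m (f t) = n) :: real)"
      by (intro sum.mono_neutral_cong_right) auto
    also have "\<dots> = (\<Sum>t\<in>C. of_bool (m t = n))"
      using sum.reindex_bij_betw[OF f, of "\<lambda>t. of_bool (m t = n) :: real"] .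
    also have "\<dots> = (\<Sum>t\<in>UNIV. of_bool (t \<in> C \<and> m t = n))"
      by (intro sum.mono_neutral_cong_left) auto
    finally show ?thesis by (simp add: z_def sum_distrib_left[symmetric] sum_subtractf)
  qed
  moreover have "(\<Sum>n\<in>UNIV. z n t) = 0" for t
    by (cases "t \<in> C") (auto simp: z_def sum_distrib_left[symmetric] sum_subtractf of_bool_def)
  moreover have "w n t \<le> - z n t" if "0 < z n t" for n t
    using that neg[of t] e e_le[of n t] by (auto simp: z_def of_bool_def split: if_splits)
  moreover have "- z n t \<le> w n t" if "z n t < 0" for n t
    using that pos[of t] e e_le[of n t] by (auto simp: z_def of_bool_def split: if_splits)
  moreover have "z (m c) c \<noteq> 0"
    using c neg[OF c] pos[OF c] e by (auto simp: z_def)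
  ultimately show thesis using that by blast
qed

section \<open>Convexity, closedness and regularity of \<open>X_set\<close> and
  \<open>Y_set\<close>\<close>

lemma inner_matrix:
  fixes x y :: "real ^ 't ^ 'n"
  shows "x \<bullet> y = (\<Sum>n\<in>UNIV. \<Sum>t\<in>UNIV. x $ n $ t * y $ n $ t)"
  by (simp add: inner_vec_def)

lemma norm_matrix_squared:
  fixes x :: "real ^ 't ^ 'n"
  shows "(norm x)\<^sup>2 = (\<Sum>n\<in>UNIV. \<Sum>t\<in>UNIV. (x $ n $ t)\<^sup>2)"
  unfolding power2_norm_eq_inner inner_matrix by (simp add: power2_eq_square)

lemma X_set_iff:
  "x \<in> X_set E lo up \<longleftrightarrow> (\<forall>n. (\<Sum>t\<in>UNIV. x $ n $ t) = E n \<and>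
    (\<forall>t. lo $ n $ t \<le> x $ n $ t \<and> x $ n $ t \<le> up $ n $ t))"
  by (simp add: X_set_def agent_set_def)

lemma convex_X_set: "convex (X_set E lo up :: (real ^ 't::finite ^ 'n::finite) set)"
  unfolding convex_alt
proof (intro ballI allI impI)
  fix x y :: "real ^ 't ^ 'n" and u :: real
  assume x: "x \<in> X_set E lo up" and y: "y \<in> X_set E lo up" and u: "0 \<le> u \<and> u \<le> 1"
  have "lo $ n $ t \<le> (1 - u) * x $ n $ t + u * y $ n $ t" for n t
  proof -
    have "lo $ n $ t = (1 - u) * lo $ n $ t + u * lo $ n $ t" by (simp add: algebra_simps)
    also have "\<dots> \<le> (1 - u) * x $ n $ t + u * y $ n $ t"
      using x y u by (intro add_mono mult_left_mono) (auto simp: X_set_iff)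
    finally show ?thesis .
  qed
  moreover have "(1 - u) * x $ n $ t + u * y $ n $ t \<le> up $ n $ t" for n t
    using x y u by (intro convex_bound_le) (auto simp: X_set_iff)
  moreover have "(1 - u) * E n + u * E n = E n" for n by (simp add: algebra_simps)
  ultimately show "(1 - u) *\<^sub>R x + u *\<^sub>R y \<in> X_set E lo up"
    using x y by (simp add: X_set_iff sum.distrib sum_distrib_left[symmetric])
qed

text \<open>Boundedness comes from the box constraints. Compactness serves to make the minimal
  distance to \<open>Y_set\<close> attained.\<close>

lemma compact_X_set: "compact (X_set E lo up :: (real ^ 't::finite ^ 'n::finite) set)"
proof -
  have "closed (X_set E lo up :: (real ^ 't ^ 'n) set)"
    unfolding X_set_iff[abs_def] X_set_def agent_set_def mem_Collect_eq
    by (intro closed_Collect_all closed_Collect_conj closed_Collect_eq closed_Collect_le continuous_intros)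
  moreover have "norm x \<le> (\<Sum>n\<in>UNIV. \<Sum>t\<in>UNIV. \<bar>lo $ n $ t\<bar> + \<bar>up $ n $ t\<bar>)"
    if "x \<in> X_set E lo up" for x :: "real ^ 't ^ 'n"
  proof -
    have "norm x \<le> (\<Sum>n\<in>UNIV. norm (x $ n))"
      unfolding norm_vec_def by (rule L2_set_le_sum) simp
    also have "\<dots> \<le> (\<Sum>n\<in>UNIV. \<Sum>t\<in>UNIV. \<bar>x $ n $ t\<bar>)"
      by (intro sum_mono norm_le_l1_cart)
    also have "\<dots> \<le> (\<Sum>n\<in>UNIV. \<Sum>t\<in>UNIV. \<bar>lo $ n $ t\<bar> + \<bar>up $ n $ t\<bar>)"
    proof (intro sum_mono)
      fix n t
      have "lo $ n $ t \<le> x $ n $ t" "x $ n $ t \<le> up $ n $ t"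
        using that by (auto simp: X_set_iff)
      then show "\<bar>x $ n $ t\<bar> \<le> \<bar>lo $ n $ t\<bar> + \<bar>up $ n $ t\<bar>" by linarith
    qed
    finally show ?thesis .
  qed
  ultimately show ?thesis
    unfolding compact_eq_bounded_closed bounded_iff by blast
qed

lemma convex_Y_set: "convex (Y_set p)"
  unfolding convex_alt
  by (auto simp: Y_set_def sum.distrib sum_distrib_left[symmetric]) (simp add: algebra_simps)

lemma closed_Y_set: "closed (Y_set p :: (real ^ 't::finite ^ 'n::finite) set)"
  unfolding Y_set_def
  by (intro closed_Collect_all closed_Collect_eq continuous_intros)

lemma Y_set_nonempty: "Y_set p \<noteq> ({} :: (real ^ 't::finite ^ 'n::finite) set)"
proof -
  have "(\<chi> n t. p $ t / real CARD('n)) \<in> (Y_set p :: (real ^ 't ^ 'n) set)"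
    by (simp add: Y_set_def)
  then show ?thesis by blast
qed

text \<open>For the projection \<open>c\<close> of \<open>a\<close> on the intersection,
  \<open>c - a\<close> has no cancellable cycle, so its norm is controlled by its column sums. The
  vector \<open>q\<close> is arbitrary because the lemma is applied to a translate of the original
  affine space.\<close>

lemma X_set_Y_set_regular:
  fixes a c0 :: "real ^ 't::finite ^ 'n::finite"
  assumes a: "a \<in> X_set E lo up" and c0: "c0 \<in> X_set E lo up" "c0 \<in> Y_set q"
  shows "\<exists>c\<in>X_set E lo up. c \<in> Y_set q \<and> (\<forall>h\<in>Y_set q. (norm (a - c))\<^sup>2 \<le>
    real CARD('n) * real CARD('t) * (real CARD('t) - 1) * (norm (a - h))\<^sup>2)"
proof -
  let ?X = "X_set E lo up" and ?Y = "Y_set q :: (real ^ 't ^ 'n) set"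
  define c where "c = closest_point (?X \<inter> ?Y) a"
  define w where "w n t = c $ n $ t - a $ n $ t" for n t
  have cl: "closed (?X \<inter> ?Y)" and cv: "convex (?X \<inter> ?Y)"
    by (intro closed_Int convex_Int compact_imp_closed[OF compact_X_set] closed_Y_set
        convex_X_set convex_Y_set)+
  have "c \<in> ?X \<inter> ?Y"
    unfolding c_def by (rule closest_point_in_set[OF cl]) (use c0 in blast)
  then have cX: "c \<in> ?X" and cY: "c \<in> ?Y" by auto
  have rows: "(\<Sum>t\<in>UNIV. w n t) = 0" for n
    using a cX by (simp add: w_def sum_subtractf X_set_iff)
  have acyclic: "\<exists>t\<in>Q. \<forall>s\<in>Q. \<not> (\<exists>n. w n s < 0 \<and> 0 < w n t)"
    if Q: "Q \<noteq> {}" for Q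
  proof (rule ccontr)
    assume "\<not> ?thesis"
    then obtain z where z: "\<And>n. (\<Sum>t\<in>UNIV. z n t) = 0" "\<And>t. (\<Sum>n\<in>UNIV. z n t) = 0"
      "\<And>n t. 0 < z n t \<Longrightarrow> w n t \<le> - z n t" "\<And>n t. z n t < 0 \<Longrightarrow> - z n t \<le> w n t"
      and nz: "\<exists>n t. z n t \<noteq> 0"
      using cycle_cancelling[OF Q, of w] by blast
    \<comment> \<open>Entries of \<open>w + z\<close> lie between 0 and those of \<open>w\<close>,
      so the entries of \<open>?c'\<close> lie between those of \<open>a\<close> and
      \<open>c\<close> and respect the bounds.\<close>
    let ?c' = "c + (\<chi> n t. z n t)"
    have "?c' \<in> ?Y" using cY z(2) by (simp add: Y_set_def sum.distrib)
    moreover have "lo $ n $ t \<le> c $ n $ t + z n t \<and> c $ n $ t + z n t \<le> up $ n $ t" for n t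
    proof -
      have "lo $ n $ t \<le> c $ n $ t \<and> c $ n $ t \<le> up $ n $ t"
        "lo $ n $ t \<le> a $ n $ t \<and> a $ n $ t \<le> up $ n $ t"
        using cX a by (auto simp: X_set_iff)
      then show ?thesis
        using z(3,4)[of n t] unfolding w_def by linarith
    qed
    then have "?c' \<in> ?X" using cX z(1) by (simp add: X_set_iff sum.distrib)
    \<comment> \<open>The projection inequality tested at \<open>?c'\<close> is contradicted below,
      since \<open>z\<close> opposes \<open>w\<close> in sign wherever it is nonzero.\<close>
    ultimately have "(a - c) \<bullet> (?c' - c) \<le> 0"
      unfolding c_def by (intro closest_point_dot[OF cv cl]) auto
    then have le: "(\<Sum>n\<in>UNIV. \<Sum>t\<in>UNIV. - w n t * z n t) \<le> 0"
      by (simp add: inner_matrix w_def)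
    have pos': "0 < - w n t * z n t" if "z n t \<noteq> 0" for n t
    proof (cases "0 < z n t")
      case True
      then show ?thesis using z(3)[of n t] by (intro mult_pos_pos) auto
    next
      case False
      then have "z n t < 0" using that by simp
      then show ?thesis using z(4)[of n t] by (intro mult_neg_neg) auto
    qed
    then have pos: "0 \<le> - w n t * z n t" for n t
      by (cases "z n t = 0") (auto intro: less_imp_le)
    obtain n t where "z n t \<noteq> 0" using nz by blast
    then have "0 < (\<Sum>n\<in>UNIV. \<Sum>t\<in>UNIV. - w n t * z n t)"
      by (intro sum_pos2[of UNIV n] sum_pos2[of UNIV t] sum_nonneg pos pos') auto
    with le show False by simp
  qed
  have "(norm (a - c))\<^sup>2 \<le> real CARD('n) * real CARD('t) * (real CARD('t) - 1) * (norm (a - h))\<^sup>2"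
    if "h \<in> ?Y" for h
  proof -
    \<comment> \<open>\<open>c\<close> and \<open>h\<close> have the same column sums
      \<open>q\<close>. Cauchy-Schwarz in each column then costs the factor
      \<open>CARD('n)\<close>.\<close>
    have col: "(\<Sum>n\<in>UNIV. w n t) = (\<Sum>n\<in>UNIV. h $ n $ t - a $ n $ t)" for t
      using that cY by (simp add: w_def sum_subtractf Y_set_def)
    have "(norm (a - c))\<^sup>2 = (\<Sum>n\<in>UNIV. \<Sum>t\<in>UNIV. (w n t)\<^sup>2)"
      by (simp add: norm_matrix_squared w_def power2_commute)
    also have "\<dots> \<le> real CARD('t) * (real CARD('t) - 1) * (\<Sum>t\<in>UNIV. (\<Sum>n\<in>UNIV. w n t)\<^sup>2)"
      by (rule zero_row_sums_bound[OF rows acyclic])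
    also have "\<dots> \<le> real CARD('t) * (real CARD('t) - 1) *
        (\<Sum>t\<in>UNIV. real CARD('n) * (\<Sum>n\<in>UNIV. (h $ n $ t - a $ n $ t)\<^sup>2))"
      unfolding col using zero_less_card_finite[where 'a='t]
      by (intro mult_left_mono sum_mono square_sum_le_card) auto
    also have "(\<Sum>t\<in>UNIV. real CARD('n) * (\<Sum>n\<in>UNIV. (h $ n $ t - a $ n $ t)\<^sup>2)) =
        real CARD('n) * (norm (a - h))\<^sup>2"
      unfolding sum_distrib_left[symmetric] norm_matrix_squared
      by (subst sum.swap) (simp add: power2_commute)
    finally show ?thesis by (simp add: mult_ac)
  qed
  with cX cY show ?thesis by blast
qed

section \<open>Convergence with the explicit rate\<close>

theorem theorem3p20:
  fixes E :: "'n::finite \<Rightarrow> real"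
    and lo up :: "real ^ 't::finite ^ 'n"
    and P :: "(real ^ 't) set"
    and p :: "real ^ 't"
    and x y :: "nat \<Rightarrow> real ^ 't ^ 'n"
  assumes E_pos: "\<And>n. E n > 0"
    and nonempty: "\<And>n. agent_set (E n) (lo $ n) (up $ n) \<noteq> {}"
    and P_total: "\<And>q. q \<in> P \<Longrightarrow> (\<Sum>t\<in>UNIV. q $ t) = (\<Sum>n\<in>UNIV. E n)"
    and P_bounds: "\<And>q t. q \<in> P \<Longrightarrow>
          (\<Sum>n\<in>UNIV. lo $ n $ t) \<le> q $ t \<and> q $ t \<le> (\<Sum>n\<in>UNIV. up $ n $ t)"
    and T_ge_2: "CARD('t) \<ge> 2"
    and p_in_P: "p \<in> P"
    and apm: "alternate_projections (X_set E lo up) (Y_set p) x y"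
  shows "\<exists>xs \<in> X_set E lo up. \<exists>ys \<in> Y_set p.
    x \<longlonglongrightarrow> xs \<and> y \<longlonglongrightarrow> ys \<and>
    norm (xs - ys) = (INF (a, b) \<in> X_set E lo up \<times> Y_set p. norm (a - b)) \<and>
    (\<forall>k. norm (x k - xs) \<le> 2 * norm (x 0 - xs) *
       (1 - 4 / (real CARD('n) * (real CARD('t) + 1)\<^sup>2 * (real CARD('t) - 1))) ^ k) \<and>
    (\<forall>k. norm (y k - ys) \<le> 2 * norm (y 0 - ys) *
       (1 - 4 / (real CARD('n) * (real CARD('t) + 1)\<^sup>2 * (real CARD('t) - 1))) ^ k)"
proof -
  let ?X = "X_set E lo up" and ?Y = "Y_set p :: (real ^ 't ^ 'n) set"
  define N T where "N = real CARD('n)" and "T = real CARD('t)"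
  \<comment> \<open>\<open>K\<close> is chosen so that \<open>1 - 1 / K\<close> is the claimed
    rate.\<close>
  define K where "K = N * (T + 1)\<^sup>2 * (T - 1) / 4"
  have N: "1 \<le> N"
    using zero_less_card_finite[where 'a='n] unfolding N_def by linarith
  have T: "2 \<le> T" using T_ge_2 by (simp add: T_def)
  have "1 * 3\<^sup>2 * 1 \<le> N * (T + 1)\<^sup>2 * (T - 1)"
    using N T by (intro mult_mono power_mono) auto
  then have K: "1 < K" by (simp add: K_def)
  \<comment> \<open>This is \<open>(T - 1)\<^sup>2 \<ge> 0\<close>; it weakens the regularity
    constant \<open>N * T * (T - 1)\<close> to \<open>K\<close>.\<close>
  have "4 * T \<le> (T + 1)\<^sup>2"
    using zero_le_power2[of "T - 1"] by (simp add: power2_eq_square algebra_simps)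
  then have "N * (T - 1) * (4 * T) \<le> N * (T - 1) * (T + 1)\<^sup>2"
    using N T by (intro mult_left_mono) auto
  then have NT: "N * T * (T - 1) \<le> K" by (simp add: K_def mult_ac)
  have "x 0 \<in> ?X" using apm by (simp add: alternate_projections_def)
  then have "?X \<noteq> {}" by auto
  then obtain a0 where a0: "a0 \<in> ?X" and min: "\<And>a. a \<in> ?X \<Longrightarrow> infdist a0 ?Y \<le> infdist a ?Y"
    using continuous_attains_inf[OF compact_X_set _ continuous_on_infdist[OF continuous_on_id]]
    by fastforce
  define b0 where "b0 = closest_point ?Y a0"
  have b0: "b0 \<in> ?Y"
    unfolding b0_def by (rule closest_point_in_set[OF closed_Y_set Y_set_nonempty])
  have minimal: "norm (a0 - b0) \<le> norm (a - b)" if "a \<in> ?X" "b \<in> ?Y" for a b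
    using min[OF that(1)] infdist_le[OF that(2), of a]
      dist_closest_point[OF closed_Y_set Y_set_nonempty, of a0 p]
    by (simp add: b0_def dist_norm)
  \<comment> \<open>Translating \<open>?Y\<close> back by the gap vector gives the affine space with
    the column sums of \<open>a0\<close>, so \<open>?X\<close> meets it exactly in the points at
    minimal distance paired through that vector.\<close>
  define q where "q = (\<chi> t. \<Sum>n\<in>UNIV. a0 $ n $ t)"
  have shift: "c + (b0 - a0) \<in> ?Y \<longleftrightarrow> c \<in> Y_set q" for c
    using b0 by (simp add: Y_set_def q_def sum.distrib sum_subtractf)
  have regular: "\<exists>c\<in>?X. c + (b0 - a0) \<in> ?Y \<and>
      (\<forall>b\<in>?Y. (norm (a - c))\<^sup>2 \<le> K * (norm (a - (b - (b0 - a0))))\<^sup>2)" if a: "a \<in> ?X" for a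
  proof -
    have "a0 \<in> Y_set q" by (simp add: Y_set_def q_def)
    then obtain c where c: "c \<in> ?X" "c \<in> Y_set q"
      and le: "\<And>h. h \<in> Y_set q \<Longrightarrow> (norm (a - c))\<^sup>2 \<le> N * T * (T - 1) * (norm (a - h))\<^sup>2"
      using X_set_Y_set_regular[OF a a0] unfolding N_def T_def by blast
    have "(norm (a - c))\<^sup>2 \<le> K * (norm (a - (b - (b0 - a0))))\<^sup>2" if "b \<in> ?Y" for b
    proof -
      have "b - (b0 - a0) \<in> Y_set q"
        using that shift[of "b - (b0 - a0)"] by simp
      from le[OF this] show ?thesis
        using mult_right_mono[OF NT zero_le_power2] order_trans by blast
    qed
    with c show ?thesis by (auto simp: shift)
  qed
  have "1 / K = 4 / (N * (T + 1)\<^sup>2 * (T - 1))" by (simp add: K_def)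
  with alternate_projections_linear_convergence[OF convex_X_set
      compact_imp_closed[OF compact_X_set] convex_Y_set closed_Y_set a0 b0 minimal K regular apm]
  show ?thesis unfolding N_def T_def by simp
qed

end
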